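(* Let $\frac12<p<1$ and let $f:\mathbb{Z}^+\to[0,\infty)$ be monotonically increasing (non-decreasing). Let $\{N_j\}_{j\ge0}$ be the discrete-time, time-inhomogeneous Markov chain on $\mathbb{N}=\{0,1,2,\dots\}$ with $N_0=1$, $N_1\sim\mathrm{Bern}\big(\frac{1-p}{p}\big)$, and, for $j\ge1$, conditionally on $N_j$, $$N_{j+1}\sim \mathrm{Bin}\Big(N_j,\tfrac{1-p}{p}\Big)+\mathrm{Poiss}\Big(\tfrac{1-p}{p}f(j)\Big),$$ where the two summands are independent (when $N_j=0$ this is $\mathrm{Poiss}(\frac{1-p}{p}f(j))$). Let $\mathbf{P}^*$ denote its law and let $K=\#\{j\in\mathbb{Z}^+: N_j=0\}$. Then $\mathbf{P}^*(K=\infty)=1$ if and only if $$\sum_{j=1}^{\infty}e^{-\frac{1-p}{2p-1}f(j)}=\infty.$$ Moreover, if this sum is finite, then $\mathbf{P}^*(K=\infty)=0$. *)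

theory Defs
  imports "HOL-Probability.Probability"
begin

text \<open>Poisson distribution with rate r >= 0 (the library version requires r > 0;
  Poiss(0) is the point mass at 0).\<close>
definition poiss_pmf :: "real \<Rightarrow> nat pmf" where
  "poiss_pmf r = (if r = 0 then return_pmf 0 else poisson_pmf r)"

definition chain_kernel :: "real \<Rightarrow> (nat \<Rightarrow> real) \<Rightarrow> nat \<Rightarrow> nat \<Rightarrow> nat pmf" where
  "chain_kernel p f j n =
     (if j = 0 then map_pmf (\<lambda>b. if b then 1 else 0) (bernoulli_pmf ((1 - p) / p))
      else map_pmf (\<lambda>(a, b). a + b)
             (pair_pmf (binomial_pmf n ((1 - p) / p)) (poiss_pmf ((1 - p) / p * f j))))"

definition is_chain :: "real \<Rightarrow> (nat \<Rightarrow> real) \<Rightarrow> 'a measure \<Rightarrow> (nat \<Rightarrow> 'a \<Rightarrow> nat) \<Rightarrow> bool" where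
  "is_chain p f M N \<longleftrightarrow>
     (\<forall>i. N i \<in> measurable M (count_space UNIV)) \<and>
     (\<forall>n x. measure M {\<omega> \<in> space M. \<forall>i\<le>n. N i \<omega> = x i} =
        (if x 0 = 1 then 1 else 0) * (\<Prod>i<n. pmf (chain_kernel p f i (x i)) (x (Suc i))))"

end

theory Submission
  imports Defs
begin

text \<open>
  Write \<open>q = (1 - p) / p\<close>. At time \<open>j\<close> the chain is distributed as the independent sum of a Bernoulli
  variable of parameter \<open>q ^ j\<close> (survival of the initial individual) and a Poisson variable of rate
  \<open>r j\<close>, where \<open>r (j + 1) = q (r j + f j)\<close>. Hence \<open>P(N\<^sub>j = 0) = (1 - q ^ j) exp (- r j)\<close>.

  As \<open>r (j + 1)\<close> is the convex combination of \<open>r j\<close> and \<open>q / (1 - q) f j\<close> with weights \<open>q\<close> and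
  \<open>1 - q\<close>, convexity of the exponential bounds the sum of these probabilities by the given series,
  and the first Borel--Cantelli lemma settles the convergent case. In the divergent case,
  \<open>r j \<le> q / (1 - q) f j\<close> makes the probabilities non-summable. Given a zero at time \<open>j\<close>, a zero at
  time \<open>j + d\<close> has probability \<open>exp (- (r (j + d) - q ^ d r j))\<close>, which exceeds the unconditional one
  by at most a constant times \<open>q ^ d\<close>. The number of zeros in a window thus has variance of the
  order of its mean, and Chebyshev's inequality shows that almost surely zeros never stop occurring.
\<close>

section \<open>A second-moment form of the second Borel-Cantelli lemma\<close>

text \<open>Chebyshev's argument for the centred count \<open>X\<close>: where no \<open>E i\<close>
  occurs, \<open>X\<close> is minus the expected count, and the integral of its square is the sum of
  covariances.\<close>

lemma (in prob_space) sum_prob_squared_mult_prob_none_le: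
  fixes E :: "'b \<Rightarrow> 'a set"
  assumes "finite A" and [measurable]: "\<And>i. i \<in> A \<Longrightarrow> E i \<in> events"
  shows "(\<Sum>i\<in>A. prob (E i))\<^sup>2 * prob (space M - (\<Union>i\<in>A. E i))
    \<le> (\<Sum>i\<in>A. \<Sum>j\<in>A. prob (E i \<inter> E j) - prob (E i) * prob (E j))"
proof -
  define S where "S = (\<Sum>i\<in>A. prob (E i))"
  define Z where "Z = space M - (\<Union>i\<in>A. E i)"
  define X where "X \<omega> = (\<Sum>i\<in>A. indicator (E i) \<omega> - prob (E i))" for \<omega>
  have Z: "Z \<in> events" 
    unfolding Z_def using assms by (intro sets.compl_sets sets.finite_UN) auto
  let ?g = "\<lambda>i j \<omega>. indicator (E i \<inter> E j) \<omega> - prob (E j) * indicator (E i) \<omega>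
      - prob (E i) * indicator (E j) \<omega> + prob (E i) * prob (E j)"
  have X2: "(X \<omega>)\<^sup>2 = (\<Sum>i\<in>A. \<Sum>j\<in>A. ?g i j \<omega>)" for \<omega>
    unfolding X_def power2_eq_square sum_product
    by (intro sum.cong refl) (simp add: indicator_inter_arith algebra_simps)
  have int: "integrable M (?g i j)" if "i \<in> A" "j \<in> A" for i j
    using that by (intro Bochner_Integration.integrable_add Bochner_Integration.integrable_diff
        integrable_mult_right integrable_real_indicator) (auto simp: emeasure_eq_measure)
  have val: "(\<integral>\<omega>. ?g i j \<omega> \<partial>M) = prob (E i \<inter> E j) - prob (E i) * prob (E j)"
    if "i \<in> A" "j \<in> A" for i j
  proof -
    have [measurable]: "E i \<in> events" "E j \<in> events" using that by auto
    have ind: "integrable M (indicator B :: 'a \<Rightarrow> real)" if "B \<in> events" for B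
      using that by (auto simp: emeasure_eq_measure)
    have "(\<integral>\<omega>. ?g i j \<omega> \<partial>M) = prob (E i \<inter> E j) - prob (E j) * prob (E i)
        - prob (E i) * prob (E j) + prob (E i) * prob (E j)"
      by (subst Bochner_Integration.integral_add Bochner_Integration.integral_diff,
          (intro Bochner_Integration.integrable_diff integrable_mult_right ind integrable_const; measurable)+)+
         (simp add: prob_space)
    then show ?thesis by simp
  qed
  have "S\<^sup>2 * prob Z = (\<integral>\<omega>. S\<^sup>2 * indicator Z \<omega> \<partial>M)"
    using Z by simp
  also have "\<dots> \<le> (\<integral>\<omega>. (X \<omega>)\<^sup>2 \<partial>M)"
  proof (rule integral_mono)
    show "integrable M (\<lambda>\<omega>. S\<^sup>2 * indicator Z \<omega>)"
      using Z by (intro integrable_mult_right integrable_real_indicator) (auto simp: emeasure_eq_measure)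
    show "integrable M (\<lambda>\<omega>. (X \<omega>)\<^sup>2)"
      unfolding X2 by (intro Bochner_Integration.integrable_sum int)
    fix \<omega> assume "\<omega> \<in> space M"
    show "S\<^sup>2 * indicator Z \<omega> \<le> (X \<omega>)\<^sup>2"
    proof (cases "\<omega> \<in> Z")
      case True
      then have "X \<omega> = (\<Sum>i\<in>A. - prob (E i))"
        unfolding X_def by (intro sum.cong) (auto simp: Z_def)
      then have "X \<omega> = - S" by (simp add: S_def sum_negf)
      with True show ?thesis by simp
    qed simp
  qed
  also have "\<dots> = (\<Sum>i\<in>A. \<Sum>j\<in>A. (\<integral>\<omega>. ?g i j \<omega> \<partial>M))"
    unfolding X2 using int
    by (subst Bochner_Integration.integral_sum, intro Bochner_Integration.integrable_sum, assumption)
       (intro sum.cong refl Bochner_Integration.integral_sum)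
  also have "\<dots> = (\<Sum>i\<in>A. \<Sum>j\<in>A. prob (E i \<inter> E j) - prob (E i) * prob (E j))"
    using val by (intro sum.cong refl)
  finally show ?thesis by (simp add: S_def Z_def)
qed

text \<open>By \<open>corr\<close> the covariances over a window sum to at most a constant times the
  expected count, so the probability of an empty window is at most of the order of the reciprocal of
  that count, which \<open>div\<close> sends to 0. The case \<open>i = j\<close> is included in
  \<open>corr\<close>: there \<open>b 0\<close> has to absorb the diagonal term.\<close>

lemma (in prob_space) borel_cantelli_AE2_summable_correlation:
  fixes E :: "nat \<Rightarrow> 'a set" and b :: "nat \<Rightarrow> real"
  assumes E [measurable]: "\<And>i. E i \<in> events"
    and corr: "\<And>i j. i \<le> j \<Longrightarrow> prob (E i \<inter> E j) \<le> prob (E i) * (prob (E j) + b (j - i))"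
    and b: "\<And>d. b d \<ge> 0" "summable b"
    and div: "\<not> summable (\<lambda>i. prob (E i))"
  shows "AE \<omega> in M. \<exists>\<^sub>\<infinity>i. \<omega> \<in> E i"
proof -
  define B where "B = suminf b"
  define S where "S m n = (\<Sum>i\<in>{m..<n}. prob (E i))" for m n
  have B: "(\<Sum>j\<in>{m..<n}. if i \<le> j then b (j - i) else 0) \<le> B" if "m \<le> i" for i m n
  proof -
    have "(\<Sum>j\<in>{m..<n}. if i \<le> j then b (j - i) else 0) = (\<Sum>j\<in>{j\<in>{m..<n}. i \<le> j}. b (j - i))"
      by (rule sum.inter_filter[symmetric]) simp
    also have "\<dots> = (\<Sum>d\<in>{..<n - i}. b d)"
      by (rule sum.reindex_bij_witness[of _ "\<lambda>d. d + i" "\<lambda>j. j - i"]) (use that in auto)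
    also have "\<dots> \<le> B" unfolding B_def using b by (intro sum_le_suminf) auto
    finally show ?thesis .
  qed
  have B0: "B \<ge> 0" unfolding B_def using b by (rule suminf_nonneg[rotated])
  have none: "(S m n)\<^sup>2 * prob (space M - (\<Union>i\<in>{m..<n}. E i)) \<le> 2 * B * S m n" for m n
  proof -
    \<comment> \<open>The excess correlation, charged to the earlier index. Adding
      \<open>u i j\<close> and \<open>u j i\<close> covers both orders of a pair; the diagonal is
      counted twice.\<close>
    define u where "u i j = prob (E i) * (if i \<le> j then b (j - i) else 0)" for i j
    have u0: "u i j \<ge> 0" for i j by (simp add: u_def b)
    have le: "prob (E i \<inter> E j) - prob (E i) * prob (E j) \<le> u i j + u j i" for i j
    proof (cases "i \<le> j")
      case True
      then show ?thesis using corr[OF True] u0[of j i] by (simp add: u_def algebra_simps)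
    next
      case False
      then show ?thesis using corr[of j i] u0[of i j] by (simp add: u_def algebra_simps Int_commute)
    qed
    have usum: "(\<Sum>i\<in>{m..<n}. \<Sum>j\<in>{m..<n}. u i j) \<le> B * S m n"
    proof -
      have "(\<Sum>i\<in>{m..<n}. \<Sum>j\<in>{m..<n}. u i j) \<le> (\<Sum>i\<in>{m..<n}. prob (E i) * B)"
        unfolding u_def sum_distrib_left[symmetric]
        by (intro sum_mono mult_left_mono B) auto
      then show ?thesis by (simp add: S_def sum_distrib_left mult.commute)
    qed
    have "(S m n)\<^sup>2 * prob (space M - (\<Union>i\<in>{m..<n}. E i))
        \<le> (\<Sum>i\<in>{m..<n}. \<Sum>j\<in>{m..<n}. prob (E i \<inter> E j) - prob (E i) * prob (E j))"
      unfolding S_def by (rule sum_prob_squared_mult_prob_none_le) auto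
    also have "\<dots> \<le> (\<Sum>i\<in>{m..<n}. \<Sum>j\<in>{m..<n}. u i j + u j i)"
      by (intro sum_mono le)
    also have "\<dots> = 2 * (\<Sum>i\<in>{m..<n}. \<Sum>j\<in>{m..<n}. u i j)"
      by (simp add: sum.distrib sum.swap[of "\<lambda>i j. u j i"])
    also have "\<dots> \<le> 2 * B * S m n" using usum by simp
    finally show ?thesis .
  qed
  have never: "prob (space M - (\<Union>i\<in>{m..}. E i)) = 0" for m
  proof (rule ccontr)
    \<comment> \<open>Every window starting at \<open>m\<close> is empty with probability at least
      \<open>\<delta>\<close>, so the second-moment bound caps all expected counts by
      \<open>2 * B / \<delta>\<close>, contradicting \<open>div\<close>.\<close>
    define \<delta> where "\<delta> = prob (space M - (\<Union>i\<in>{m..}. E i))"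
    assume "prob (space M - (\<Union>i\<in>{m..}. E i)) \<noteq> 0"
    then have \<delta>: "\<delta> > 0" by (simp add: \<delta>_def zero_less_measure_iff)
    have S: "S m n \<le> 2 * B / \<delta>" for n
    proof (cases "S m n > 0")
      case True
      have "\<delta> \<le> prob (space M - (\<Union>i\<in>{m..<n}. E i))"
        unfolding \<delta>_def by (intro finite_measure_mono) auto
      then have "(S m n)\<^sup>2 * \<delta> \<le> 2 * B * S m n"
        using none[of m n] by (meson mult_left_mono order_trans zero_le_power2)
      then have "S m n * \<delta> \<le> 2 * B" using True by (simp add: power2_eq_square)
      then show ?thesis using \<delta> by (simp add: field_simps)
    next
      case False
      moreover have "2 * B / \<delta> \<ge> 0" using \<delta> B0 by simp
      ultimately show ?thesis by linarith
    qed
    have "summable (\<lambda>i. prob (E (i + m)))"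
    proof (rule summableI_nonneg_bounded)
      fix n
      have "(\<Sum>i<n. prob (E (i + m))) = S m (n + m)"
        unfolding S_def by (rule sum.reindex_bij_witness[of _ "\<lambda>i. i - m" "\<lambda>i. i + m"]) auto
      then show "(\<Sum>i<n. prob (E (i + m))) \<le> 2 * B / \<delta>" using S by simp
    qed simp
    then show False using div summable_iff_shift by blast
  qed
  have "AE \<omega> in M. \<forall>m. \<exists>i\<ge>m. \<omega> \<in> E i"
  proof (subst AE_all_countable, intro allI)
    fix m
    have "AE \<omega> in M. \<omega> \<notin> space M - (\<Union>i\<in>{m..}. E i)"
      using never[of m] by (intro AE_not_in) (auto simp: null_sets_def emeasure_eq_measure)
    then show "AE \<omega> in M. \<exists>i\<ge>m. \<omega> \<in> E i" using AE_space by eventually_elim auto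
  qed
  then show ?thesis by (simp add: INFM_nat_le)
qed

section \<open>Generating functions of the transition laws\<close>

lemma nn_integral_power_binomial_pmf:
  assumes "q \<in> {0..1}" "0 \<le> s"
  shows "(\<integral>\<^sup>+k. ennreal (s ^ k) \<partial>binomial_pmf n q) = ennreal ((1 - q + q * s) ^ n)"
proof (induction n)
  case 0
  then show ?case using assms by (simp add: binomial_pmf_0)
next
  case (Suc n)
  have 1: "0 \<le> (1 - q + q * s) ^ n" using assms by simp
  have "(\<integral>\<^sup>+k. ennreal (s ^ k) \<partial>binomial_pmf (Suc n) q)
      = ennreal s * ennreal ((1 - q + q * s) ^ n) * ennreal q + ennreal ((1 - q + q * s) ^ n) * ennreal (1 - q)"
    using assms by (simp add: binomial_pmf_Suc ennreal_mult nn_integral_cmult Suc)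
  also have "\<dots> = ennreal (s * (1 - q + q * s) ^ n * q + (1 - q + q * s) ^ n * (1 - q))"
    using assms 1 by (simp add: ennreal_mult'' ennreal_mult' ennreal_plus)
  also have "s * (1 - q + q * s) ^ n * q + (1 - q + q * s) ^ n * (1 - q) = (1 - q + q * s) ^ Suc n"
    by (simp add: algebra_simps)
  finally show ?case .
qed

lemma nn_integral_power_poiss_pmf:
  assumes "0 \<le> r" "0 \<le> s"
  shows "(\<integral>\<^sup>+k. ennreal (s ^ k) \<partial>poiss_pmf r) = ennreal (exp (- r * (1 - s)))"
proof (cases "r = 0")
  case True
  then show ?thesis by (simp add: poiss_pmf_def)
next
  case False
  then have r: "r > 0" using assms by simp
  have sums: "(\<lambda>k. exp (- r) * ((r * s) ^ k /\<^sub>R fact k)) sums (exp (- r) * exp (r * s))"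
    by (intro sums_mult exp_converges)
  have summand: "ennreal (pmf (poiss_pmf r) k) * ennreal (s ^ k) = ennreal (exp (- r) * ((r * s) ^ k /\<^sub>R fact k))" for k
  proof -
    have "ennreal (pmf (poiss_pmf r) k) * ennreal (s ^ k) = ennreal (pmf (poiss_pmf r) k * s ^ k)"
      using assms by (simp add: ennreal_mult)
    also have "pmf (poiss_pmf r) k * s ^ k = exp (- r) * ((r * s) ^ k /\<^sub>R fact k)"
      using r by (simp add: poiss_pmf_def power_mult_distrib divide_inverse)
    finally show ?thesis .
  qed
  have "(\<integral>\<^sup>+k. ennreal (s ^ k) \<partial>poiss_pmf r)
      = (\<Sum>k. ennreal (exp (- r) * ((r * s) ^ k /\<^sub>R fact k)))"
    by (simp only: nn_integral_measure_pmf nn_integral_count_space_nat summand)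
  also have "\<dots> = ennreal (exp (- r) * exp (r * s))"
    using sums assms by (intro suminf_ennreal_eq) auto
  also have "exp (- r) * exp (r * s) = exp (- r * (1 - s))"
    by (simp add: exp_add[symmetric] algebra_simps)
  finally show ?thesis .
qed

text \<open>Independence of survivors and immigrants splits the integral. What matters for iteration
  is that the result is again a power with the state as exponent: in terms of
  \<open>t = 1 - s\<close>, one step back in time replaces \<open>t\<close> by \<open>q * t\<close>
  at the cost of a deterministic factor.\<close>

lemma nn_integral_power_chain_kernel:
  assumes "1/2 < p" "p < 1" "0 \<le> f j" "0 \<le> s" "j \<ge> 1"
  defines "q \<equiv> (1 - p) / p"
  shows "(\<integral>\<^sup>+k. ennreal (s ^ k) \<partial>chain_kernel p f j n)
    = ennreal (exp (- (q * f j) * (1 - s))) * ennreal ((1 - q + q * s) ^ n)"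
proof -
  have q: "0 \<le> q" "q \<le> 1" using assms by (auto simp: q_def field_simps)
  have "(\<integral>\<^sup>+k. ennreal (s ^ k) \<partial>chain_kernel p f j n)
    = (\<integral>\<^sup>+a. \<integral>\<^sup>+b. ennreal (s ^ a) * ennreal (s ^ b) \<partial>poiss_pmf (q * f j) \<partial>binomial_pmf n q)"
    using assms by (simp add: chain_kernel_def nn_integral_pair_pmf' power_add ennreal_mult)
  also have "\<dots> = ennreal (exp (- (q * f j) * (1 - s))) * ennreal ((1 - q + q * s) ^ n)"
    using assms q by (simp add: nn_integral_cmult nn_integral_multc nn_integral_power_poiss_pmf
        nn_integral_power_binomial_pmf mult.commute)
  finally show ?thesis .
qed

section \<open>The law of the path up to a fixed time\<close>

text \<open>Paths are recorded in reverse, with the current state at index 0.\<close>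

primrec path_pmf :: "(nat \<Rightarrow> nat \<Rightarrow> nat pmf) \<Rightarrow> nat \<Rightarrow> nat \<Rightarrow> nat list pmf" where
  "path_pmf K a 0 = return_pmf [a]"
| "path_pmf K a (Suc n) = bind_pmf (path_pmf K a n) (\<lambda>xs. map_pmf (\<lambda>y. y # xs) (K n (xs ! 0)))"

lemma length_path_pmf: "xs \<in> set_pmf (path_pmf K a n) \<Longrightarrow> length xs = Suc n"
  by (induction n arbitrary: xs) auto

lemma pmf_path_pmf_Suc:
  "pmf (path_pmf K a (Suc n)) (y # ys) = pmf (path_pmf K a n) ys * pmf (K n (ys ! 0)) y"
proof -
  have "pmf (map_pmf (\<lambda>z. z # xs) (K n (xs ! 0))) (y # ys) = pmf (K n (ys ! 0)) y * indicator {ys} xs" for xs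
  proof (cases "xs = ys")
    case True
    then show ?thesis
      using pmf_map_inj'[of "\<lambda>z. z # ys" "K n (ys ! 0)" y] by (simp add: inj_on_def)
  next
    case False
    then show ?thesis by (auto intro!: pmf_map_outside)
  qed
  then show ?thesis by (simp add: pmf_bind measure_pmf_single)
qed

lemma pmf_path_pmf:
  "pmf (path_pmf K a n) (rev (map x [0..<Suc n]))
    = (if x 0 = a then 1 else 0) * (\<Prod>i<n. pmf (K i (x i)) (x (Suc i)))"
proof (induction n)
  case 0
  then show ?case by (simp add: indicator_def)
next
  case (Suc n)
  have "rev (map x [0..<Suc (Suc n)]) = x (Suc n) # rev (map x [0..<Suc n])" by simp
  moreover have "rev (map x [0..<Suc n]) ! 0 = x n" by simp
  ultimately show ?case by (simp only: pmf_path_pmf_Suc Suc) simp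
qed

text \<open>This moves the computation from the arbitrary space \<open>M\<close> to a concrete law
  on lists, where the last transition can be integrated out. Cylinder probabilities determine that
  law because there are only countably many lists.\<close>

lemma (in prob_space) distr_markov_path:
  assumes N [measurable]: "\<And>i. N i \<in> measurable M (count_space UNIV)"
    and cyl: "\<And>n x. prob {\<omega> \<in> space M. \<forall>i\<le>n. N i \<omega> = x i}
      = (if x 0 = a then 1 else 0) * (\<Prod>i<n. pmf (K i (x i)) (x (Suc i)))"
  shows "(\<lambda>\<omega>. rev (map (\<lambda>i. N i \<omega>) [0..<Suc n])) \<in> measurable M (count_space UNIV)" (is ?meas)
    and "distr M (count_space UNIV) (\<lambda>\<omega>. rev (map (\<lambda>i. N i \<omega>) [0..<Suc n])) = measure_pmf (path_pmf K a n)"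
      (is ?eq)
proof -
  let ?L = "\<lambda>\<omega>. rev (map (\<lambda>i. N i \<omega>) [0..<Suc n])"
  have eq: "?L -` {xs} \<inter> space M = (if length xs = Suc n
      then {\<omega> \<in> space M. \<forall>i\<le>n. N i \<omega> = xs ! (n - i)} else {})" for xs
  proof (cases "length xs = Suc n")
    case True
    have "?L \<omega> = xs \<longleftrightarrow> (\<forall>i\<le>n. N i \<omega> = xs ! (n - i))" for \<omega>
    proof -
      have "?L \<omega> = xs \<longleftrightarrow> map (\<lambda>i. N i \<omega>) [0..<Suc n] = rev xs"
        by (rule rev_swap)
      also have "\<dots> \<longleftrightarrow> (\<forall>i\<le>n. N i \<omega> = xs ! (n - i))"
        using True by (auto simp: list_eq_iff_nth_eq rev_nth less_Suc_eq_le simp del: upt_Suc)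
      finally show ?thesis .
    qed
    then show ?thesis using True by auto
  qed auto
  show meas: ?meas
    unfolding measurable_count_space_eq2_countable by (auto simp: eq simp del: upt_Suc)
  have *: "emeasure M (?L -` {xs} \<inter> space M) = ennreal (pmf (path_pmf K a n) xs)" for xs
  proof (cases "length xs = Suc n")
    case True
    let ?x = "\<lambda>i. xs ! (n - i)"
    have "xs = rev (map ?x [0..<Suc n])"
      using True by (auto simp: list_eq_iff_nth_eq rev_nth less_Suc_eq_le simp del: upt_Suc)
    then have "pmf (path_pmf K a n) xs = pmf (path_pmf K a n) (rev (map ?x [0..<Suc n]))"
      by (rule arg_cong)
    also have "\<dots> = prob {\<omega> \<in> space M. \<forall>i\<le>n. N i \<omega> = ?x i}"
      unfolding cyl by (rule pmf_path_pmf)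
    finally have "pmf (path_pmf K a n) xs = prob {\<omega> \<in> space M. \<forall>i\<le>n. N i \<omega> = ?x i}" .
    then show ?thesis using True by (simp add: eq emeasure_eq_measure del: upt_Suc)
  next
    case False
    then have "pmf (path_pmf K a n) xs = 0"
      using length_path_pmf by (metis set_pmf_iff)
    then show ?thesis using False by (simp add: eq del: upt_Suc)
  qed
  show ?eq
  proof (rule measure_eqI_countable)
    fix xs
    show "emeasure (distr M (count_space UNIV) ?L) {xs} = emeasure (measure_pmf (path_pmf K a n)) {xs}"
      using meas by (simp add: emeasure_distr * emeasure_pmf_single del: upt_Suc)
  qed auto
qed

section \<open>Zero probabilities of the chain\<close>

text \<open>The transition out of time 0 has no immigration, so the value \<open>f 0\<close> must not enter.\<close>

primrec poisson_rate :: "real \<Rightarrow> (nat \<Rightarrow> real) \<Rightarrow> nat \<Rightarrow> real" where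
  "poisson_rate q f 0 = 0"
| "poisson_rate q f (Suc j) = q * (poisson_rate q f j + (if j = 0 then 0 else f j))"

text \<open>Integrating out the current state replaces \<open>t\<close> by \<open>q * t\<close>,
  hence the induction on \<open>d\<close> with \<open>t\<close> arbitrary. The exponent collects the
  part of the rate at time \<open>j + d\<close> that stems from arrivals after time
  \<open>j\<close>. The indicator carries along an event about the state at time \<open>j\<close>,
  which is entry \<open>d\<close> of the reversed path.\<close>

lemma nn_integral_path_pmf_chain:
  fixes p :: real and f :: "nat \<Rightarrow> real"
  assumes p: "1/2 < p" "p < 1" and f: "\<And>j. j \<ge> 1 \<Longrightarrow> f j \<ge> 0" and j: "j \<ge> 1" and "0 \<le> t" "t \<le> 1"
  defines "q \<equiv> (1 - p) / p"
  shows "(\<integral>\<^sup>+xs. indicator A (xs ! d) * ennreal ((1 - t) ^ (xs ! 0)) \<partial>path_pmf (chain_kernel p f) a (j + d))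
    = ennreal (exp (- t * (poisson_rate q f (j + d) - q ^ d * poisson_rate q f j)))
      * (\<integral>\<^sup>+xs. indicator A (xs ! 0) * ennreal ((1 - q ^ d * t) ^ (xs ! 0)) \<partial>path_pmf (chain_kernel p f) a j)"
  using \<open>0 \<le> t\<close> \<open>t \<le> 1\<close>
proof (induction d arbitrary: t)
  case 0
  then show ?case by simp
next
  case (Suc d)
  have q: "0 \<le> q" "q \<le> 1" using p by (auto simp: q_def field_simps)
  have qt: "0 \<le> q * t" "q * t \<le> 1" using q Suc.prems by (auto intro: mult_le_one)
  have kern: "(\<integral>\<^sup>+k. ennreal ((1 - t) ^ k) \<partial>chain_kernel p f (j + d) n)
      = ennreal (exp (- (q * f (j + d)) * t)) * ennreal ((1 - q * t) ^ n)" for n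
  proof -
    have eq: "1 - q + q * (1 - t) = 1 - q * t" by (simp add: algebra_simps)
    show ?thesis
      using nn_integral_power_chain_kernel[of p f "j + d" "1 - t" n, folded q_def] p f j Suc.prems
      unfolding eq by simp
  qed
  \<comment> \<open>The newest state is the head, so removing it turns entry \<open>Suc d\<close>
    into entry \<open>d\<close> and leaves the event at time \<open>j\<close> untouched.\<close>
  have "(\<integral>\<^sup>+xs. indicator A (xs ! Suc d) * ennreal ((1 - t) ^ (xs ! 0)) \<partial>path_pmf (chain_kernel p f) a (j + Suc d))
    = (\<integral>\<^sup>+xs. ennreal (exp (- (q * f (j + d)) * t)) *
        (indicator A (xs ! d) * ennreal ((1 - q * t) ^ (xs ! 0))) \<partial>path_pmf (chain_kernel p f) a (j + d))"
    by (simp add: nn_integral_cmult kern mult_ac del: mult_minus_left)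
  also have "\<dots> = ennreal (exp (- (q * f (j + d)) * t)) *
      (ennreal (exp (- (q * t) * (poisson_rate q f (j + d) - q ^ d * poisson_rate q f j)))
      * (\<integral>\<^sup>+xs. indicator A (xs ! 0) * ennreal ((1 - q ^ d * (q * t)) ^ (xs ! 0)) \<partial>path_pmf (chain_kernel p f) a j))"
    using Suc.IH[OF qt] by (simp add: nn_integral_cmult)
  also have "\<dots> = ennreal (exp (- (q * f (j + d)) * t + - (q * t) * (poisson_rate q f (j + d) - q ^ d * poisson_rate q f j)))
      * (\<integral>\<^sup>+xs. indicator A (xs ! 0) * ennreal ((1 - q ^ Suc d * t) ^ (xs ! 0)) \<partial>path_pmf (chain_kernel p f) a j)"
    by (simp only: exp_add ennreal_mult[OF exp_ge_zero exp_ge_zero] mult.assoc power_Suc2)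
  also have "- (q * f (j + d)) * t + - (q * t) * (poisson_rate q f (j + d) - q ^ d * poisson_rate q f j)
      = - t * (poisson_rate q f (j + Suc d) - q ^ Suc d * poisson_rate q f j)"
    using j by (simp add: algebra_simps)
  finally show ?case .
qed

text \<open>Both formulas evaluate the generating function at \<open>t = 1\<close>. The first starts
  from the Bernoulli law at time 1, because the transition out of time 0 has a different form; the
  second restricts to a zero at time \<open>j\<close>, where the remaining power equals 1.\<close>

lemma chain_zero_probabilities:
  fixes p :: real and f :: "nat \<Rightarrow> real"
  assumes p: "1/2 < p" "p < 1" and f: "\<And>j. j \<ge> 1 \<Longrightarrow> f j \<ge> 0"
    and M: "prob_space M" and chain: "is_chain p f M N" and j: "j \<ge> 1"
  defines "q \<equiv> (1 - p) / p"
  shows "measure M {\<omega> \<in> space M. N j \<omega> = 0} = (1 - q ^ j) * exp (- poisson_rate q f j)"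
    and "measure M {\<omega> \<in> space M. N j \<omega> = 0 \<and> N (j + d) \<omega> = 0}
      = measure M {\<omega> \<in> space M. N j \<omega> = 0} * exp (- (poisson_rate q f (j + d) - q ^ d * poisson_rate q f j))"
proof -
  interpret prob_space M by fact
  let ?P = "path_pmf (chain_kernel p f) 1"
  have q: "0 \<le> q" "q \<le> 1" using p by (auto simp: q_def field_simps)
  have N: "N i \<in> measurable M (count_space UNIV)" for i using chain by (simp add: is_chain_def)
  have cyl: "prob {\<omega> \<in> space M. \<forall>i\<le>n. N i \<omega> = x i}
      = (if x 0 = 1 then 1 else 0) * (\<Prod>i<n. pmf (chain_kernel p f i (x i)) (x (Suc i)))" for n x
    using chain by (simp add: is_chain_def)
  \<comment> \<open>As \<open>0 ^ 0 = 1\<close>, the power is the indicator of a zero; it is kept as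
    \<open>1 - 1\<close> to match the generating function at \<open>t = 1\<close>.\<close>
  have joint: "ennreal (prob {\<omega> \<in> space M. N k \<omega> \<in> A \<and> N (k + d) \<omega> = 0})
      = (\<integral>\<^sup>+xs. indicator A (xs ! d) * ennreal ((1 - 1) ^ (xs ! 0)) \<partial>?P (k + d))" for A k d
  proof -
    let ?L = "\<lambda>\<omega>. rev (map (\<lambda>i. N i \<omega>) [0..<Suc (k + d)])"
    have L: "?L \<in> measurable M (count_space UNIV)"
      "distr M (count_space UNIV) ?L = measure_pmf (?P (k + d))"
      using distr_markov_path[OF N cyl] by blast+
    have nth: "?L \<omega> ! i = N (k + d - i) \<omega>" if "i \<le> k + d" for i \<omega>
      using that by (simp add: rev_nth less_Suc_eq_le del: upt_Suc)
    have "{\<omega> \<in> space M. N k \<omega> \<in> A \<and> N (k + d) \<omega> = 0} = ?L -` {xs. xs ! d \<in> A \<and> xs ! 0 = 0} \<inter> space M"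
      using nth[of d] nth[of 0] by (auto simp del: upt_Suc)
    then have "ennreal (prob {\<omega> \<in> space M. N k \<omega> \<in> A \<and> N (k + d) \<omega> = 0})
      = emeasure (distr M (count_space UNIV) ?L) {xs. xs ! d \<in> A \<and> xs ! 0 = 0}"
      using L(1) by (simp add: emeasure_distr emeasure_eq_measure del: upt_Suc)
    also have "\<dots> = (\<integral>\<^sup>+xs. indicator {xs. xs ! d \<in> A \<and> xs ! 0 = 0} xs \<partial>?P (k + d))"
      unfolding L(2) by simp
    also have "\<dots> = (\<integral>\<^sup>+xs. indicator A (xs ! d) * ennreal ((1 - 1) ^ (xs ! 0)) \<partial>?P (k + d))"
      by (intro nn_integral_cong) (auto simp: indicator_def power_0_left)
    finally show ?thesis .
  qed
  have first: "(\<integral>\<^sup>+xs. ennreal (s ^ (xs ! 0)) \<partial>?P 1) = ennreal (1 - q * (1 - s))" if "s \<ge> 0" for s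
  proof -
    have "(\<integral>\<^sup>+xs. ennreal (s ^ (xs ! 0)) \<partial>?P 1) = ennreal s * ennreal q + ennreal (1 - q)"
      using q by (simp add: chain_kernel_def q_def)
    also have "\<dots> = ennreal (s * q + (1 - q))"
      using q that by (simp add: ennreal_mult ennreal_plus)
    also have "s * q + (1 - q) = 1 - q * (1 - s)" by (simp add: algebra_simps)
    finally show ?thesis .
  qed
  \<comment> \<open>The rate at time 1 is 0, so the correction to the exponent vanishes, and
    survival for \<open>e\<close> further steps gives \<open>q * q ^ e = q ^ j\<close>.\<close>
  obtain e where e: "j = 1 + e" using j by (metis le_iff_add)
  have qe: "q ^ e \<le> 1" "q ^ j \<le> 1" 
    using q by (auto intro: power_le_one mult_le_one simp: e)
  have "ennreal (prob {\<omega> \<in> space M. N j \<omega> = 0})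
      = ennreal (prob {\<omega> \<in> space M. N 1 \<omega> \<in> UNIV \<and> N (1 + e) \<omega> = 0})"
    by (simp add: e)
  also have "\<dots> = ennreal (exp (- 1 * (poisson_rate q f (1 + e) - q ^ e * poisson_rate q f 1)))
      * (\<integral>\<^sup>+xs. indicator UNIV (xs ! 0) * ennreal ((1 - q ^ e * 1) ^ (xs ! 0)) \<partial>?P 1)"
    unfolding joint q_def by (rule nn_integral_path_pmf_chain) (use p f in auto)
  also have "\<dots> = ennreal (exp (- poisson_rate q f j)) * ennreal (1 - q ^ j)"
  proof -
    have "(\<integral>\<^sup>+xs. ennreal ((1 - q ^ e) ^ (xs ! 0)) \<partial>?P 1) = ennreal (1 - q ^ j)"
      using first[of "1 - q ^ e"] qe(1) by (simp add: e power_add del: path_pmf.simps One_nat_def)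
    then show ?thesis by (simp add: e del: path_pmf.simps)
  qed
  also have "\<dots> = ennreal ((1 - q ^ j) * exp (- poisson_rate q f j))"
    using qe(2) by (simp add: ennreal_mult mult.commute)
  finally show "prob {\<omega> \<in> space M. N j \<omega> = 0} = (1 - q ^ j) * exp (- poisson_rate q f j)"
    using qe(2) by (simp add: ennreal_inj)
  have zero: "(\<integral>\<^sup>+xs. indicator {0} (xs ! 0) * ennreal (s ^ (xs ! 0)) \<partial>?P j)
      = ennreal (prob {\<omega> \<in> space M. N j \<omega> = 0})" for s
  proof -
    have "(\<integral>\<^sup>+xs. indicator {0} (xs ! 0) * ennreal (s ^ (xs ! 0)) \<partial>?P j)
        = (\<integral>\<^sup>+xs. indicator {0} (xs ! 0) * ennreal ((1 - 1) ^ (xs ! 0)) \<partial>?P (j + 0))"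
      by (auto intro!: nn_integral_cong simp: indicator_def)
    then show ?thesis using joint[of j "{0}" 0] by simp
  qed
  have "ennreal (prob {\<omega> \<in> space M. N j \<omega> = 0 \<and> N (j + d) \<omega> = 0})
      = ennreal (prob {\<omega> \<in> space M. N j \<omega> \<in> {0} \<and> N (j + d) \<omega> = 0})"
    by simp
  also have "\<dots> = ennreal (exp (- 1 * (poisson_rate q f (j + d) - q ^ d * poisson_rate q f j)))
      * (\<integral>\<^sup>+xs. indicator {0} (xs ! 0) * ennreal ((1 - q ^ d * 1) ^ (xs ! 0)) \<partial>?P j)"
    unfolding joint q_def by (rule nn_integral_path_pmf_chain) (use p f j in auto)
  also have "\<dots> = ennreal (prob {\<omega> \<in> space M. N j \<omega> = 0}
      * exp (- (poisson_rate q f (j + d) - q ^ d * poisson_rate q f j)))"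
    unfolding zero by (simp add: ennreal_mult mult.commute)
  finally show "prob {\<omega> \<in> space M. N j \<omega> = 0 \<and> N (j + d) \<omega> = 0}
      = prob {\<omega> \<in> space M. N j \<omega> = 0} * exp (- (poisson_rate q f (j + d) - q ^ d * poisson_rate q f j))"
    by (simp add: ennreal_inj)
qed

section \<open>Estimates for the Poisson rate\<close>

lemma poisson_rate_nonneg:
  assumes "0 \<le> q" "\<And>j. j \<ge> 1 \<Longrightarrow> f j \<ge> 0"
  shows "0 \<le> poisson_rate q f j"
  using assms by (induction j) auto

lemma mono_poisson_rate:
  assumes "0 \<le> q" "\<And>j. j \<ge> 1 \<Longrightarrow> f j \<ge> 0" "mono_on {1..} f"
  shows "mono (poisson_rate q f)"
proof (rule incseq_SucI)
  fix j
  show "poisson_rate q f j \<le> poisson_rate q f (Suc j)"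
  proof (induction j)
    case (Suc j)
    have "(if j = 0 then 0 else f j) \<le> f (Suc j)"
      using assms mono_onD[OF assms(3), of j "Suc j"] by auto
    then show ?case using Suc \<open>0 \<le> q\<close>
      unfolding poisson_rate.simps(2)[of q f "Suc j"]
      by (subst poisson_rate.simps(2)) (intro mult_left_mono, auto)
  qed simp
qed

text \<open>The constant \<open>c = q / (1 - q)\<close> solves \<open>q * (c + 1) = c\<close>, so
  the recursion carries the bound at \<open>j\<close> to \<open>c * f j\<close> at
  \<open>Suc j\<close>, and \<open>f\<close> is monotone.\<close>

lemma poisson_rate_le:
  assumes "0 \<le> q" "q < 1" "\<And>j. j \<ge> 1 \<Longrightarrow> f j \<ge> 0" "mono_on {1..} f" "j \<ge> 1"
  shows "poisson_rate q f j \<le> q / (1 - q) * f j"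
  using \<open>j \<ge> 1\<close>
proof (induction j rule: dec_induct)
  case base
  then show ?case using assms by simp
next
  case (step j)
  have "poisson_rate q f (Suc j) \<le> q * (q / (1 - q) * f j + f j)"
    using step assms by (auto intro!: mult_left_mono)
  also have "\<dots> = q / (1 - q) * f j" using assms by (simp add: field_simps)
  also have "\<dots> \<le> q / (1 - q) * f (Suc j)"
    using assms step by (intro mult_left_mono mono_onD[OF assms(4)]) auto
  finally show ?case .
qed

lemma summable_exp_neg_poisson_rate:
  assumes "0 < q" "q < 1" and sum: "summable (\<lambda>j. exp (- (q / (1 - q)) * f (Suc j)))"
  shows "summable (\<lambda>j. exp (- poisson_rate q f (Suc j)))"
proof -
  define a where "a j = exp (- poisson_rate q f (Suc j))" for j
  define b where "b j = exp (- (q / (1 - q)) * f (Suc j))" for j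
  have step: "a (Suc j) \<le> q * a j + (1 - q) * b j" for j
  proof -
    have "exp (q * x + (1 - q) * y) \<le> q * exp x + (1 - q) * exp y" for x y
      using convex_onD[OF exp_convex, of "1 - q"] assms by simp
    then have "exp (q * (- poisson_rate q f (Suc j)) + (1 - q) * (- (q / (1 - q)) * f (Suc j)))
        \<le> q * a j + (1 - q) * b j"
      unfolding a_def b_def .
    moreover have "q * (- poisson_rate q f (Suc j)) + (1 - q) * (- (q / (1 - q)) * f (Suc j))
        = - poisson_rate q f (Suc (Suc j))"
      using assms by (simp add: field_simps)
    ultimately show ?thesis by (simp only: a_def)
  qed
  have b: "(\<Sum>j<n. b j) \<le> suminf b" for n
    using sum unfolding b_def by (intro sum_le_suminf) auto
  have "(\<Sum>j<n. a j) \<le> a 0 / (1 - q) + suminf b" for n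
  proof -
    \<comment> \<open>With one extra term, the shifted sum has the same range as the original one,
      so \<open>q\<close> times that sum can be absorbed on the left.\<close>
    have "(\<Sum>j<n. a j) \<le> (\<Sum>j<Suc n. a j)" by (simp add: a_def)
    also have "\<dots> = a 0 + (\<Sum>j<n. a (Suc j))" by (rule sum.lessThan_Suc_shift)
    also have "\<dots> \<le> a 0 + (\<Sum>j<n. q * a j + (1 - q) * b j)"
      by (intro add_left_mono sum_mono step)
    also have "\<dots> = a 0 + q * (\<Sum>j<n. a j) + (1 - q) * (\<Sum>j<n. b j)"
      by (simp add: sum.distrib sum_distrib_left)
    also have "\<dots> \<le> a 0 + q * (\<Sum>j<n. a j) + (1 - q) * suminf b"
      using b assms by (intro add_left_mono mult_left_mono) auto
    finally have "(1 - q) * (\<Sum>j<n. a j) \<le> a 0 + (1 - q) * suminf b" by (simp add: algebra_simps)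
    then show ?thesis using assms by (simp add: field_simps)
  qed
  then show ?thesis unfolding a_def by (intro summableI_nonneg_bounded) auto
qed

text \<open>Applied with \<open>a\<close> and \<open>b\<close> the rates at two times
  \<open>d\<close> apart and \<open>x = q ^ d\<close>, this measures how much a zero at the first
  time favours one at the second. The error must not depend on \<open>a\<close>: the linearisation
  error \<open>x * a\<close> is compensated by \<open>exp (- ((1 - q) * a))\<close>, as
  \<open>y * exp (- y)\<close> is at most 1.\<close>

lemma exp_neg_diff_le:
  fixes a b q x :: real
  assumes "0 \<le> a" "a \<le> b" "0 \<le> x" "x \<le> q" "q < 1"
  shows "exp (- (b - x * a)) \<le> exp (- b) + x / (1 - q)"
proof -
  have "exp (- (b - x * a)) - exp (- b) = exp (- (b - x * a)) * (1 - exp (- (x * a)))"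
    by (simp add: right_diff_distrib exp_add[symmetric])
  also have "\<dots> \<le> exp (- ((1 - q) * a)) * (x * a)"
  proof (rule mult_mono)
    have "x * a \<le> q * a" using assms by (intro mult_right_mono)
    then show "exp (- (b - x * a)) \<le> exp (- ((1 - q) * a))"
      using assms by (simp add: algebra_simps)
    show "1 - exp (- (x * a)) \<le> x * a" using exp_ge_add_one_self[of "- (x * a)"] by linarith
  qed (use assms in auto)
  also have "\<dots> = x / (1 - q) * (exp (- ((1 - q) * a)) * ((1 - q) * a))"
    using assms by simp
  also have "\<dots> \<le> x / (1 - q) * 1"
  proof (rule mult_left_mono)
    have "exp (- y) * y \<le> 1" for y :: real
    proof -
      have "y \<le> exp y" using exp_ge_add_one_self[of y] by linarith
      then have "exp (- y) * y \<le> exp (- y) * exp y" by (intro mult_left_mono) auto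
      then show ?thesis by (simp add: exp_add[symmetric])
    qed
    then show "exp (- ((1 - q) * a)) * ((1 - q) * a) \<le> 1" .
  qed (use assms in auto)
  finally show ?thesis by simp
qed

section \<open>The zero-one dichotomy\<close>

theorem theorem4:
  fixes p :: real and f :: "nat \<Rightarrow> real" and M :: "'a measure" and N :: "nat \<Rightarrow> 'a \<Rightarrow> nat"
  assumes "1/2 < p" and "p < 1"
    and "\<And>j. j \<ge> 1 \<Longrightarrow> f j \<ge> 0"
    and "mono_on {1..} f"
    and "prob_space M"
    and "is_chain p f M N"
  shows "(measure M {\<omega> \<in> space M. infinite {j. j \<ge> 1 \<and> N j \<omega> = 0}} = 1
           \<longleftrightarrow> \<not> summable (\<lambda>j. exp (- ((1 - p) / (2 * p - 1)) * f (Suc j))))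
     \<and> (summable (\<lambda>j. exp (- ((1 - p) / (2 * p - 1)) * f (Suc j)))
           \<longrightarrow> measure M {\<omega> \<in> space M. infinite {j. j \<ge> 1 \<and> N j \<omega> = 0}} = 0)"
proof -
  interpret prob_space M by fact
  define q where "q = (1 - p) / p"
  have q: "0 < q" "q < 1" using assms(1,2) by (auto simp: q_def field_simps)
  have c: "(1 - p) / (2 * p - 1) = q / (1 - q)" using assms(1,2) by (simp add: q_def field_simps)
  define r where "r = poisson_rate q f"
  have r0: "0 \<le> r j" for j unfolding r_def using q assms by (intro poisson_rate_nonneg) auto
  have r_mono: "i \<le> j \<Longrightarrow> r i \<le> r j" for i j
    using mono_poisson_rate[of q f] q assms(3,4) unfolding r_def by (auto dest: monoD)
  \<comment> \<open>Shifted by one, since zeros are counted from time 1 on.\<close>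
  define E where "E i = {\<omega> \<in> space M. N (Suc i) \<omega> = 0}" for i
  have [measurable]: "N i \<in> measurable M (count_space UNIV)" for i
    using assms(6) by (simp add: is_chain_def)
  have E [measurable]: "E i \<in> events" for i unfolding E_def by measurable
  note zero = chain_zero_probabilities[OF assms(1-3,5,6), folded q_def, folded r_def]
  have PE: "prob (E i) = (1 - q ^ Suc i) * exp (- r (Suc i))" for i
    unfolding E_def by (rule zero(1)) auto
  have infinitely: "infinite {j. j \<ge> 1 \<and> N j \<omega> = 0} \<longleftrightarrow> (\<exists>\<^sub>\<infinity>i. \<omega> \<in> E i)" if "\<omega> \<in> space M" for \<omega>
  proof -
    have "{j. j \<ge> 1 \<and> N j \<omega> = 0} = Suc ` {i. \<omega> \<in> E i}"
      using that by (auto simp: E_def image_iff Suc_le_eq gr0_conv_Suc)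
    then show ?thesis by (simp add: frequently_cofinite finite_image_iff)
  qed
  define Z where "Z = {\<omega> \<in> space M. infinite {j. j \<ge> 1 \<and> N j \<omega> = 0}}"
  have Z_eq: "Z = {\<omega> \<in> space M. \<exists>\<^sub>\<infinity>i. \<omega> \<in> E i}" unfolding Z_def using infinitely by auto
  have Z: "Z \<in> events" unfolding Z_eq INFM_nat_le by measurable
  have *: "prob Z = 0" if "summable (\<lambda>j. exp (- (q / (1 - q)) * f (Suc j)))"
  proof -
    have "summable (\<lambda>i. prob (E i))"
    proof (rule summable_comparison_test')
      show "summable (\<lambda>i. exp (- r (Suc i)))"
        unfolding r_def using q that by (intro summable_exp_neg_poisson_rate)
      show "norm (prob (E i)) \<le> exp (- r (Suc i))" for i
        using q by (simp add: PE power_le_one mult_left_le_one_le del: power_Suc)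
    qed
    then have "AE \<omega> in M. eventually (\<lambda>i. \<omega> \<in> space M - E i) sequentially"
      by (intro borel_cantelli_AE1) (auto simp: emeasure_eq_measure)
    then have "AE \<omega> in M. \<omega> \<notin> Z"
      by eventually_elim (auto simp: Z_eq frequently_def cofinite_eq_sequentially elim: eventually_mono)
    then show ?thesis using Z by (simp add: prob_eq_0)
  qed
  have **: "prob Z = 1" if div: "\<not> summable (\<lambda>j. exp (- (q / (1 - q)) * f (Suc j)))"
  proof -
    \<comment> \<open>The summand \<open>1 / (1 - q)\<close> comes from
      \<open>exp_neg_diff_le\<close>. The summand 1 pays for the factor \<open>1 - q ^ Suc j\<close>
      in \<open>prob (E j)\<close> and also makes \<open>b 0\<close> at least 1, which settles
      \<open>i = j\<close>.\<close>
    define b where "b d = q ^ d * (1 / (1 - q) + 1)" for d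
    have "AE \<omega> in M. \<exists>\<^sub>\<infinity>i. \<omega> \<in> E i"
    proof (rule borel_cantelli_AE2_summable_correlation)
      show "0 \<le> b d" for d using q by (simp add: b_def)
      show "summable b" unfolding b_def using q by (intro summable_mult2 summable_geometric) auto
      show "\<not> summable (\<lambda>i. prob (E i))"
      proof
        assume "summable (\<lambda>i. prob (E i))"
        \<comment> \<open>Dividing by \<open>1 - q\<close> compensates for the factor
          \<open>1 - q ^ Suc i\<close>, which is at least \<open>1 - q\<close>.\<close>
        then have "summable (\<lambda>i. prob (E i) / (1 - q))" by (rule summable_divide)
        then have "summable (\<lambda>j. exp (- (q / (1 - q)) * f (Suc j)))"
        proof (rule summable_comparison_test')
          fix i
          have "q ^ Suc i \<le> q" using q power_decreasing[of 1 "Suc i" q] by simp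
          moreover have "r (Suc i) \<le> q / (1 - q) * f (Suc i)"
            unfolding r_def using q assms by (intro poisson_rate_le) auto
          ultimately have "(1 - q) * exp (- (q / (1 - q)) * f (Suc i)) \<le> prob (E i)"
            unfolding PE using q by (intro mult_mono) (auto simp: power_le_one simp del: power_Suc)
          then show "norm (exp (- (q / (1 - q)) * f (Suc i))) \<le> prob (E i) / (1 - q)"
            using q by (simp add: pos_le_divide_eq mult.commute)
        qed
        with div show False ..
      qed
      fix i j :: nat assume "i \<le> j"
      then obtain d where j: "j = i + d" by (metis le_iff_add)
      have "prob (E i \<inter> E j) = prob (E i) * exp (- (r (Suc i + d) - q ^ d * r (Suc i)))" if "d > 0"
      proof -
        have "E i \<inter> E j = {\<omega> \<in> space M. N (Suc i) \<omega> = 0 \<and> N (Suc i + d) \<omega> = 0}"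
          by (auto simp: E_def j)
        then show ?thesis using zero(2)[of "Suc i" d] by (simp add: E_def)
      qed
      \<comment> \<open>For \<open>d = 0\<close> the power \<open>q ^ d\<close> is 1 and exceeds
        \<open>q\<close>, so this comparison is confined to distinct times.\<close>
      moreover have "exp (- (r (Suc i + d) - q ^ d * r (Suc i))) \<le> prob (E j) + b d" if "d > 0"
      proof -
        have "q ^ d \<le> q" using q that power_decreasing[of 1 d q] by simp
        then have "exp (- (r (Suc i + d) - q ^ d * r (Suc i))) \<le> exp (- r (Suc j)) + q ^ d / (1 - q)"
          using exp_neg_diff_le[of "r (Suc i)" "r (Suc i + d)" "q ^ d" q] r0 r_mono[of "Suc i" "Suc i + d"] q
          by (simp add: j)
        moreover have "exp (- r (Suc j)) = prob (E j) + q ^ Suc j * exp (- r (Suc j))"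
          unfolding PE by (simp add: algebra_simps)
        moreover have "q ^ Suc j * exp (- r (Suc j)) \<le> q ^ d * 1"
          using q r0 by (intro mult_mono power_decreasing) (auto simp: j)
        ultimately show ?thesis by (simp add: b_def algebra_simps)
      qed
      moreover have "1 \<le> b 0" using q by (simp add: b_def)
      ultimately show "prob (E i \<inter> E j) \<le> prob (E i) * (prob (E j) + b (j - i))"
        by (cases "d = 0") (auto simp: j intro!: mult_left_mono mult_le_cancel_left1[THEN iffD2] add_increasing)
    qed simp
    then have "AE \<omega> in M. \<omega> \<in> Z"
      using AE_space by eventually_elim (simp add: Z_eq)
    then show ?thesis using Z by (simp add: prob_eq_1)
  qed
  show ?thesis unfolding c using * ** unfolding Z_def by auto
qed

end
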